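(* For every integer $n \geq 3$, the Möbius ladder $M_n$ is not total threshold colorable; that is, there are no integers $r \geq t$ such that $M_n$ is $(r,t)$-total-threshold-colorable.
   Context: All graphs are finite, simple and undirected. The Möbius ladder $M_n$ ($n\ge 3$) is the graph with vertices $v_0,\ldots,v_{2n-1}$, whose edges are $v_iv_{i+1}$ for $i=0,\ldots,2n-1$ (indices mod $2n$) together with the "spokes" $v_iv_{i+n}$ for $i=0,\ldots,n-1$. A near-far-labeling of a graph $G$ is a pair $(N,F)$ with $N \subseteq E(G)$ and $F = E(G)\setminus N$. For integers $r \geq t$, an $(r,t)$-threshold-coloring of $G$ with respect to $(N,F)$ is a map $c: V(G) \to \{0,\ldots,r-1\}$ with $|c(u)-c(v)| \leq t$ for every $uv \in N$ and $|c(u)-c(v)| > t$ for every $uv \in F$. $G$ is $(r,t)$-total-threshold-colorable if it has an $(r,t)$-threshold-coloring with respect to every near-far-labeling, and total threshold colorable if it is $(r,t)$-total-threshold-colorable for some integers $r \geq t$. *)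

theory Defs
  imports Main
begin

text \<open>A graph is a pair of a vertex set and a set of edges; the edge \<open>uv\<close> is the
  two-element set \<open>{u, v}\<close>, so edges are undirected and there are no parallel edges.\<close>

type_synonym 'a graph = "'a set \<times> 'a set set"

abbreviation verts :: "'a graph \<Rightarrow> 'a set" where
  "verts G \<equiv> fst G"

abbreviation edges :: "'a graph \<Rightarrow> 'a set set" where
  "edges G \<equiv> snd G"

definition finite_simple_graph :: "'a graph \<Rightarrow> bool" where
  "finite_simple_graph G \<longleftrightarrow>
     finite (verts G) \<and> (\<forall>e \<in> edges G. e \<subseteq> verts G \<and> card e = 2)"

text \<open>The vertex \<open>v\<^sub>i\<close> is represented by the number \<open>i\<close>.\<close>

definition moebius_ladder :: "nat \<Rightarrow> nat graph" where
  "moebius_ladder n =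
     ({0..<2 * n},
      {{i, (i + 1) mod (2 * n)} | i. i < 2 * n} \<union> {{i, i + n} | i. i < n})"

definition near_far_labeling :: "'a graph \<Rightarrow> 'a set set \<Rightarrow> 'a set set \<Rightarrow> bool" where
  "near_far_labeling G N F \<longleftrightarrow> N \<subseteq> edges G \<and> F = edges G - N"

text \<open>A colouring is a total function on the vertex type; only its values on the vertices of
  the graph matter. The parameters \<open>r\<close> and \<open>t\<close> range over all integers, negative ones
  included.\<close>

definition threshold_coloring ::
  "int \<Rightarrow> int \<Rightarrow> 'a graph \<Rightarrow> 'a set set \<Rightarrow> 'a set set \<Rightarrow> ('a \<Rightarrow> int) \<Rightarrow> bool" where
  "threshold_coloring r t G N F c \<longleftrightarrow>
     (\<forall>v \<in> verts G. c v \<in> {0..r - 1}) \<and>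
     (\<forall>u v. {u, v} \<in> N \<longrightarrow> \<bar>c u - c v\<bar> \<le> t) \<and>
     (\<forall>u v. {u, v} \<in> F \<longrightarrow> \<bar>c u - c v\<bar> > t)"

definition rt_total_threshold_colorable :: "int \<Rightarrow> int \<Rightarrow> 'a graph \<Rightarrow> bool" where
  "rt_total_threshold_colorable r t G \<longleftrightarrow>
     (\<forall>N F. near_far_labeling G N F \<longrightarrow> (\<exists>c. threshold_coloring r t G N F c))"

definition total_threshold_colorable :: "'a graph \<Rightarrow> bool" where
  "total_threshold_colorable G \<longleftrightarrow> (\<exists>r t. r \<ge> t \<and> rt_total_threshold_colorable r t G)"

lemma finite_simple_graph_moebius_ladder:
  assumes "n \<ge> 3"
  shows "finite_simple_graph (moebius_ladder n)"
proof -
  have "{i, (i + 1) mod (2 * n)} \<subseteq> {0..<2 * n} \<and> card {i, (i + 1) mod (2 * n)} = 2"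
    if "i < 2 * n" for i
  proof (cases "i + 1 = 2 * n")
    case True
    with assms have "i \<noteq> 0" by linarith
    with True that show ?thesis by simp
  next
    case False
    with that have "(i + 1) mod (2 * n) = i + 1" by simp
    with that False show ?thesis by simp
  qed
  moreover have "{i, i + n} \<subseteq> {0..<2 * n} \<and> card {i, i + n} = 2" if "i < n" for i
    using that by simp
  ultimately show ?thesis
    unfolding finite_simple_graph_def moebius_ladder_def by fastforce
qed

end

theory Submission
  imports Defs
begin

text \<open>Label the edges of the outer cycle near and the spokes far, and follow the difference of the
  colours at the two ends of a spoke around the cycle. Between consecutive spokes it changes by at
  most \<open>2 * t\<close>, while its absolute value always exceeds \<open>t\<close>; hence its sign never changes. But after
  \<open>n\<close> steps the same spoke is reached with its ends exchanged, so the sign must have flipped.\<close>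

text \<open>A step of size at most \<open>2 * t\<close> down from a value above \<open>t\<close>
  ends above \<open>-t\<close>, and \<open>far\<close> values avoid the band from \<open>-t\<close>
  to \<open>t\<close>, so it ends above \<open>t\<close> again.\<close>

lemma gt_if_step_le_twice:
  fixes d :: "nat \<Rightarrow> int"
  assumes "d 0 > t"
    and "\<And>i. i < n \<Longrightarrow> \<bar>d (Suc i) - d i\<bar> \<le> 2 * t"
    and "\<And>i. i \<le> n \<Longrightarrow> \<bar>d i\<bar> > t"
    and "i \<le> n"
  shows "d i > t"
  using \<open>i \<le> n\<close>
proof (induction i)
  case 0
  show ?case by (fact assms(1))
next
  case (Suc i)
  then show ?case
    using assms(2)[of i] assms(3)[of "Suc i"] by linarith
qed

lemma no_sign_flip:
  fixes d :: "nat \<Rightarrow> int"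
  assumes "t \<ge> 0"
    and step: "\<And>i. i < n \<Longrightarrow> \<bar>d (Suc i) - d i\<bar> \<le> 2 * t"
    and far: "\<And>i. i \<le> n \<Longrightarrow> \<bar>d i\<bar> > t"
  shows "d n \<noteq> - d 0"
proof (cases "d 0 > t")
  case True
  then have "d n > t"
    using gt_if_step_le_twice[of t d n n] step far by blast
  with True \<open>t \<ge> 0\<close> show ?thesis by linarith
next
  case False
  \<comment> \<open>Now \<open>d 0 < -t\<close>, and the negated sequence satisfies the same
    bounds.\<close>
  with far[of 0] have neg: "- d 0 > t" by linarith
  moreover have "\<bar>- d (Suc i) - - d i\<bar> \<le> 2 * t" if "i < n" for i
    using step[OF that] by linarith
  ultimately have "- d n > t"
    using gt_if_step_le_twice[of t "\<lambda>i. - d i" n n] far by simp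
  with neg \<open>t \<ge> 0\<close> show ?thesis by linarith
qed

text \<open>The ends of a cycle edge differ by 1, or by \<open>2 * n - 1\<close> for the closing
  edge; those of a spoke differ by \<open>n\<close>, which is neither once
  \<open>n \<ge> 2\<close>.\<close>

lemma spoke_not_on_cycle:
  fixes n :: nat
  assumes "n \<ge> 2" "i < n" "j < 2 * n"
  shows "{i, i + n} \<noteq> {j, (j + 1) mod (2 * n)}"
proof (cases "j + 1 = 2 * n")
  case True
  with assms show ?thesis by (auto simp: doubleton_eq_iff)
next
  case False
  with assms have "(j + 1) mod (2 * n) = j + 1" by simp
  with assms show ?thesis by (auto simp: doubleton_eq_iff)
qed

theorem theorem2:
  fixes n :: nat
  assumes "n \<ge> 3"
  shows "\<not> total_threshold_colorable (moebius_ladder n)"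
proof
  assume "total_threshold_colorable (moebius_ladder n)"
  then obtain r t where total: "rt_total_threshold_colorable r t (moebius_ladder n)"
    unfolding total_threshold_colorable_def by blast
  define N where "N = {{i, (i + 1) mod (2 * n)} | i. i < 2 * n}"
  define F where "F = edges (moebius_ladder n) - N"
  have "near_far_labeling (moebius_ladder n) N F"
    unfolding near_far_labeling_def F_def by (auto simp: N_def moebius_ladder_def)
  with total obtain c where c: "threshold_coloring r t (moebius_ladder n) N F c"
    unfolding rt_total_threshold_colorable_def by blast
  have near: "\<bar>c i - c ((i + 1) mod (2 * n))\<bar> \<le> t" if "i < 2 * n" for i
    using c that unfolding threshold_coloring_def N_def by blast
  have far: "\<bar>c i - c (i + n)\<bar> > t" if "i < n" for i
  proof -
    have "{i, i + n} \<notin> N"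
      using spoke_not_on_cycle[of n i] assms that by (auto simp: N_def)
    with that have "{i, i + n} \<in> F"
      by (auto simp: F_def moebius_ladder_def)
    with c show ?thesis unfolding threshold_coloring_def by blast
  qed
  \<comment> \<open>For \<open>i \<le> n\<close> the reduction matters only at \<open>i = n\<close>,
    where it sends \<open>2 * n\<close> to 0 and so gives spoke 0 reversed.\<close>
  define d where "d i = c i - c ((i + n) mod (2 * n))" for i
  have d_n: "d n = - d 0"
    using assms by (simp add: d_def mult_2[symmetric])
  have "t \<ge> 0" using near[of 0] assms by linarith
  moreover have "\<bar>d (Suc i) - d i\<bar> \<le> 2 * t" if "i < n" for i
  proof -
    have "\<bar>c i - c (Suc i)\<bar> \<le> t"
      using near[of i] that by simp
    \<comment> \<open>For \<open>i = n - 1\<close> this is the closing edge of the cycle, from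
      \<open>2 * n - 1\<close> to 0.\<close>
    moreover have "\<bar>c (i + n) - c ((Suc i + n) mod (2 * n))\<bar> \<le> t"
      using near[of "i + n"] that by simp
    ultimately show ?thesis
      using that by (simp add: d_def)
  qed
  moreover have "\<bar>d i\<bar> > t" if "i \<le> n" for i
  proof (cases "i < n")
    case True
    then show ?thesis using far[of i] by (simp add: d_def)
  next
    case False
    with that have "i = n" by simp
    with d_n far[of 0] assms show ?thesis by (simp add: d_def)
  qed
  ultimately show False
    using no_sign_flip[of t n d] d_n by blast
qed

end
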